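(* Let $p:\mathbb{R}\to\mathbb{R}$ be an $L^\infty$ function such that $x'=-x^2+p(t)$ has an attractor-repeller pair $(\tilde a,\tilde r)$, and let $\Gamma:\mathbb{R}\to\mathbb{R}$ be bounded and continuous with finite limits $\lim_{t\to\pm\infty}\Gamma(t)$. Assume also that $\Gamma$ is nondecreasing, and that there exist $\bar t_1<\bar t_2$ such that $\Gamma$ is $C^2$ on $[\bar t_1,\bar t_2]$ and $$\left(\frac14-\frac{(\bar t_1+\bar t_2-2t)^2}{4\,(\bar t_2-\bar t_1)^2}\right)(\tilde a(t)-\tilde r(t))^2+\frac{1}{\bar t_2-\bar t_1}\,(\tilde a(t)-\tilde r(t))<\Gamma'(t)\quad\text{for all }t\in[\bar t_1,\bar t_2].$$ Then there exists $h_*>0$ such that the equation $x'=-\big(x-\Gamma^h(t)\big)^2+p(t)$ has no bounded solutions (defined on $\mathbb{R}$) for all $h\in[0,h_*]$.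
   Context: Solutions are Carathéodory solutions (absolutely continuous on compact intervals, satisfying the equation for a.e. $t$). For $h>0$, $\Gamma^h(t):=\Gamma(jh)$ for $t\in[jh,(j+1)h)$, $j\in\mathbb{Z}$; and $\Gamma^0:=\Gamma$. Nondecreasing means $\Gamma(t_1)\le\Gamma(t_2)$ if $t_1<t_2$. Attractor-repeller pair for $x'=-x^2+p(t)$: the pair $(\tilde a,\tilde r)$ formed by the maximal and minimal bounded solutions on $\mathbb{R}$, when they exist and are hyperbolic with $\tilde a$ attractive and $\tilde r$ repulsive: there exist $k\ge1,\beta>0$ with $\exp\int_s^t-2\tilde a(l)\,dl\le ke^{-\beta(t-s)}$ for $t\ge s$ and $\exp\int_s^t-2\tilde r(l)\,dl\le ke^{\beta(t-s)}$ for $t\le s$. This is equivalent to $\tilde a,\tilde r$ existing with $\inf_{t\in\mathbb{R}}(\tilde a(t)-\tilde r(t))>0$. *)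

theory Defs
  imports "HOL-Analysis.Analysis"
begin

text \<open>
  Absolute continuity in the epsilon-delta sense, the finite families of non-overlapping
  subintervals being the library's divisions. For an interval \<open>k = {u..v}\<close> with \<open>u \<le> v\<close>
  we have \<open>Inf k = u\<close> and \<open>Sup k = v\<close>. (The constant \<open>absolutely_continuous\<close>
  of the library concerns measures.)
\<close>

definition abs_continuous_on_interval :: "real \<Rightarrow> real \<Rightarrow> (real \<Rightarrow> real) \<Rightarrow> bool" where
  "abs_continuous_on_interval a b f \<longleftrightarrow>
     (\<forall>\<epsilon>>0. \<exists>\<delta>>0. \<forall>d. d division_of \<Union>d \<and> \<Union>d \<subseteq> {a..b} \<and> (\<Sum>k\<in>d. Sup k - Inf k) < \<delta>
        \<longrightarrow> (\<Sum>k\<in>d. \<bar>f (Sup k) - f (Inf k)\<bar>) < \<epsilon>)"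

definition caratheodory_solution :: "(real \<Rightarrow> real \<Rightarrow> real) \<Rightarrow> (real \<Rightarrow> real) \<Rightarrow> bool" where
  "caratheodory_solution f x \<longleftrightarrow>
     (\<forall>a b. abs_continuous_on_interval a b x) \<and>
     (AE t in lebesgue. (x has_real_derivative f t (x t)) (at t))"

definition bounded_solution :: "(real \<Rightarrow> real \<Rightarrow> real) \<Rightarrow> (real \<Rightarrow> real) \<Rightarrow> bool" where
  "bounded_solution f x \<longleftrightarrow> caratheodory_solution f x \<and> bounded (range x)"

definition L_infinity :: "(real \<Rightarrow> real) \<Rightarrow> bool" where
  "L_infinity p \<longleftrightarrow> p \<in> borel_measurable lebesgue \<and> (\<exists>C. AE t in lebesgue. \<bar>p t\<bar> \<le> C)"

text \<open>
  Attractor-repeller pair \<open>(a, r)\<close> of \<open>x' = - x\<^sup>2 + p t\<close>. The integrals are oriented: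
  in the condition on \<open>r\<close> the upper limit \<open>t\<close> lies to the left of \<open>s\<close>.
\<close>

definition attractor_repeller_pair ::
  "(real \<Rightarrow> real) \<Rightarrow> (real \<Rightarrow> real) \<Rightarrow> (real \<Rightarrow> real) \<Rightarrow> bool" where
  "attractor_repeller_pair p a r \<longleftrightarrow>
     (let f = (\<lambda>t x. - x\<^sup>2 + p t) in
        bounded_solution f a \<and> bounded_solution f r \<and>
        (\<forall>x. bounded_solution f x \<longrightarrow> (\<forall>t. r t \<le> x t \<and> x t \<le> a t))) \<and>
     (\<exists>k\<ge>1. \<exists>\<beta>>0.
        (\<forall>s t. s \<le> t \<longrightarrow> exp (LBINT l=ereal s..ereal t. - 2 * a l) \<le> k * exp (- \<beta> * (t - s))) \<and>
        (\<forall>s t. t \<le> s \<longrightarrow> exp (LBINT l=ereal s..ereal t. - 2 * r l) \<le> k * exp (\<beta> * (t - s))))"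

text \<open>
  For \<open>h > 0\<close>, the integer \<open>j\<close> with \<open>t \<in> [j h, (j + 1) h)\<close> is \<open>\<lfloor>t / h\<rfloor>\<close>.
  Only \<open>h \<ge> 0\<close> is meaningful.
\<close>

definition piecewise_const :: "(real \<Rightarrow> real) \<Rightarrow> real \<Rightarrow> real \<Rightarrow> real" where
  "piecewise_const \<Gamma> h t = (if h = 0 then \<Gamma> t else \<Gamma> (of_int \<lfloor>t / h\<rfloor> * h))"

text \<open>
  \<open>C\<^sup>2\<close> on a nondegenerate interval; at an endpoint belonging to \<open>S\<close> the derivatives
  are one-sided.
\<close>

definition C2_on :: "real set \<Rightarrow> (real \<Rightarrow> real) \<Rightarrow> bool" where
  "C2_on S f \<longleftrightarrow>
     (\<exists>f' f''. (\<forall>t\<in>S. (f has_real_derivative f' t) (at t within S)) \<and>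
              (\<forall>t\<in>S. (f' has_real_derivative f'' t) (at t within S)) \<and>
              continuous_on S f'')"

end

theory Submission
  imports Defs
begin

text \<open>If \<open>x\<close> is a bounded solution of \<open>x' = - (x - G)\<^sup>2 + p\<close> with \<open>G\<close> nondecreasing, then
  \<open>y = x - G\<close> solves \<open>y' = - y\<^sup>2 + p - dG\<close>, and \<open>dG \<ge> 0\<close>. Hence \<open>y\<close> must stay between \<open>r\<close> and \<open>a\<close>:
  below \<open>r\<close> the repulsion of \<open>r\<close> makes \<open>r - y\<close> grow exponentially forwards, above \<open>a\<close> the
  attraction of \<open>a\<close> makes \<open>y - a\<close> grow exponentially backwards. Writing \<open>y = r + \<theta> (a - r)\<close>, one
  gets \<open>\<theta>' = \<theta> (1 - \<theta>) (a - r) - \<Gamma>' / (a - r)\<close> when \<open>G = \<Gamma>\<close>, and the hypothesis says precisely that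
  the affine function decreasing from 1 at \<open>t\<^sub>1\<close> to 0 at \<open>t\<^sub>2\<close> is a strict supersolution. So \<open>y\<close> is
  pushed below \<open>r\<close> by a fixed amount at \<open>t\<^sub>2\<close>, and this survives replacing \<open>\<Gamma>\<close> by the uniformly
  close \<open>\<Gamma>\<^sup>h\<close>. All comparisons are between products with an integrating factor, so no
  local theory of the differential equation is needed.\<close>

section \<open>Absolute continuity: closure properties and continuity\<close>

lemma abs_continuous_on_intervalD:
  assumes "abs_continuous_on_interval a b f" "\<epsilon> > 0"
  obtains \<delta> where "\<delta> > 0"
    "\<forall>d. d division_of \<Union>d \<and> \<Union>d \<subseteq> {a..b} \<and> (\<Sum>k\<in>d. Sup k - Inf k) < \<delta>
        \<longrightarrow> (\<Sum>k\<in>d. \<bar>f (Sup k) - f (Inf k)\<bar>) < \<epsilon>"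
proof -
  have "\<exists>\<delta>>0. \<forall>d. d division_of \<Union>d \<and> \<Union>d \<subseteq> {a..b} \<and> (\<Sum>k\<in>d. Sup k - Inf k) < \<delta>
        \<longrightarrow> (\<Sum>k\<in>d. \<bar>f (Sup k) - f (Inf k)\<bar>) < \<epsilon>" (is "\<exists>\<delta>>0. ?P \<delta>")
    using assms(1)[unfolded abs_continuous_on_interval_def, THEN spec, THEN mp, OF assms(2)] .
  then show ?thesis by (elim exE conjE) (rule that)
qed

lemma division_Inf_Sup:
  fixes d :: "real set set"
  assumes "d division_of \<Union>d" "\<Union>d \<subseteq> {a..b}" "k \<in> d"
  shows "a \<le> Inf k" "Inf k \<le> Sup k" "Sup k \<le> b"
proof -
  obtain u v where k: "k = cbox u v" and "k \<noteq> {}"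
    using division_ofD(3,4)[OF assms(1,3)] by blast
  then have "u \<le> v" "k = {u..v}" by auto
  moreover from this have "u \<in> \<Union>d" "v \<in> \<Union>d" using assms(3) by auto
  ultimately show "a \<le> Inf k" "Inf k \<le> Sup k" "Sup k \<le> b"
    using assms(2) by auto
qed

lemma abs_continuous_on_interval_lipschitz:
  assumes "\<And>u v. a \<le> u \<Longrightarrow> u \<le> v \<Longrightarrow> v \<le> b \<Longrightarrow> \<bar>f v - f u\<bar> \<le> L * (v - u)"
  shows "abs_continuous_on_interval a b f"
  unfolding abs_continuous_on_interval_def
proof (intro allI impI)
  fix \<epsilon> :: real assume "\<epsilon> > 0"
  \<comment> \<open>\<open>L\<close> may be zero or negative; a positive constant above it is needed
    as the divisor of \<epsilon>.\<close>
  define M where "M = \<bar>L\<bar> + 1"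
  have M: "M > 0" "L \<le> M" by (auto simp: M_def)
  show "\<exists>\<delta>>0. \<forall>d. d division_of \<Union>d \<and> \<Union>d \<subseteq> {a..b} \<and> (\<Sum>k\<in>d. Sup k - Inf k) < \<delta>
        \<longrightarrow> (\<Sum>k\<in>d. \<bar>f (Sup k) - f (Inf k)\<bar>) < \<epsilon>"
  proof (intro exI[of _ "\<epsilon> / M"] conjI allI impI)
    show "\<epsilon> / M > 0" using \<open>\<epsilon> > 0\<close> M by simp
    fix d assume d: "d division_of \<Union>d \<and> \<Union>d \<subseteq> {a..b} \<and> (\<Sum>k\<in>d. Sup k - Inf k) < \<epsilon> / M"
    have "(\<Sum>k\<in>d. \<bar>f (Sup k) - f (Inf k)\<bar>) \<le> (\<Sum>k\<in>d. M * (Sup k - Inf k))"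
    proof (rule sum_mono)
      fix k assume "k \<in> d"
      note k = division_Inf_Sup[OF conjunct1[OF d] conjunct1[OF conjunct2[OF d]] this]
      have "\<bar>f (Sup k) - f (Inf k)\<bar> \<le> L * (Sup k - Inf k)"
        using assms k by blast
      also have "\<dots> \<le> M * (Sup k - Inf k)"
        using M k by (intro mult_right_mono) auto
      finally show "\<bar>f (Sup k) - f (Inf k)\<bar> \<le> M * (Sup k - Inf k)" .
    qed
    also have "\<dots> = M * (\<Sum>k\<in>d. Sup k - Inf k)" by (simp add: sum_distrib_left)
    also have "\<dots> < \<epsilon>" using d M by (simp add: field_simps)
    finally show "(\<Sum>k\<in>d. \<bar>f (Sup k) - f (Inf k)\<bar>) < \<epsilon>" .
  qed
qed

text \<open>Summing the bound on increments over a division reduces the claim to \<open>f\<close>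
  and \<open>g\<close>, each granted half of \<epsilon>. This one estimate serves sums, differences
  and products.\<close>

lemma abs_continuous_on_interval_dominated:
  assumes "abs_continuous_on_interval a b f" "abs_continuous_on_interval a b g"
    and "\<And>u v. a \<le> u \<Longrightarrow> u \<le> v \<Longrightarrow> v \<le> b \<Longrightarrow> \<bar>F v - F u\<bar> \<le> M * (\<bar>f v - f u\<bar> + \<bar>g v - g u\<bar>)"
  shows "abs_continuous_on_interval a b F"
  unfolding abs_continuous_on_interval_def
proof (intro allI impI)
  fix \<epsilon> :: real assume "\<epsilon> > 0"
  define K where "K = \<bar>M\<bar> + 1"
  have K: "K > 0" "M \<le> K" by (auto simp: K_def)
  then have pos: "\<epsilon> / (2 * K) > 0" using \<open>\<epsilon> > 0\<close> by simp
  obtain \<delta>1 where 1: "\<delta>1 > 0"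
    "\<forall>d. d division_of \<Union>d \<and> \<Union>d \<subseteq> {a..b} \<and> (\<Sum>k\<in>d. Sup k - Inf k) < \<delta>1
        \<longrightarrow> (\<Sum>k\<in>d. \<bar>f (Sup k) - f (Inf k)\<bar>) < \<epsilon> / (2 * K)"
    by (rule abs_continuous_on_intervalD[OF assms(1) pos])
  obtain \<delta>2 where 2: "\<delta>2 > 0"
    "\<forall>d. d division_of \<Union>d \<and> \<Union>d \<subseteq> {a..b} \<and> (\<Sum>k\<in>d. Sup k - Inf k) < \<delta>2
        \<longrightarrow> (\<Sum>k\<in>d. \<bar>g (Sup k) - g (Inf k)\<bar>) < \<epsilon> / (2 * K)"
    by (rule abs_continuous_on_intervalD[OF assms(2) pos])
  show "\<exists>\<delta>>0. \<forall>d. d division_of \<Union>d \<and> \<Union>d \<subseteq> {a..b} \<and> (\<Sum>k\<in>d. Sup k - Inf k) < \<delta>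
        \<longrightarrow> (\<Sum>k\<in>d. \<bar>F (Sup k) - F (Inf k)\<bar>) < \<epsilon>"
  proof (intro exI[of _ "min \<delta>1 \<delta>2"] conjI allI impI)
    show "min \<delta>1 \<delta>2 > 0" using 1 2 by simp
    fix d assume d: "d division_of \<Union>d \<and> \<Union>d \<subseteq> {a..b} \<and> (\<Sum>k\<in>d. Sup k - Inf k) < min \<delta>1 \<delta>2"
    have "(\<Sum>k\<in>d. \<bar>F (Sup k) - F (Inf k)\<bar>)
        \<le> (\<Sum>k\<in>d. K * (\<bar>f (Sup k) - f (Inf k)\<bar> + \<bar>g (Sup k) - g (Inf k)\<bar>))"
    proof (rule sum_mono)
      fix k assume "k \<in> d"
      note k = division_Inf_Sup[OF conjunct1[OF d] conjunct1[OF conjunct2[OF d]] this]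
      have "\<bar>F (Sup k) - F (Inf k)\<bar> \<le> M * (\<bar>f (Sup k) - f (Inf k)\<bar> + \<bar>g (Sup k) - g (Inf k)\<bar>)"
        using assms(3) k by blast
      also have "\<dots> \<le> K * (\<bar>f (Sup k) - f (Inf k)\<bar> + \<bar>g (Sup k) - g (Inf k)\<bar>)"
        using K by (intro mult_right_mono) auto
      finally show "\<bar>F (Sup k) - F (Inf k)\<bar> \<le> K * (\<bar>f (Sup k) - f (Inf k)\<bar> + \<bar>g (Sup k) - g (Inf k)\<bar>)" .
    qed
    also have "\<dots> = K * ((\<Sum>k\<in>d. \<bar>f (Sup k) - f (Inf k)\<bar>) + (\<Sum>k\<in>d. \<bar>g (Sup k) - g (Inf k)\<bar>))"
      by (simp add: sum_distrib_left sum.distrib distrib_left)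
    also have "\<dots> < K * (\<epsilon> / (2 * K) + \<epsilon> / (2 * K))"
      using d 1(2)[rule_format, of d] 2(2)[rule_format, of d] K by (intro mult_strict_left_mono add_strict_mono) auto
    also have "\<dots> = \<epsilon>" using K by simp
    finally show "(\<Sum>k\<in>d. \<bar>F (Sup k) - F (Inf k)\<bar>) < \<epsilon>" .
  qed
qed

lemma abs_continuous_on_interval_add:
  assumes "abs_continuous_on_interval a b f" "abs_continuous_on_interval a b g"
  shows "abs_continuous_on_interval a b (\<lambda>t. f t + g t)"
  using assms by (rule abs_continuous_on_interval_dominated[where M = 1]) auto

lemma abs_continuous_on_interval_diff:
  assumes "abs_continuous_on_interval a b f" "abs_continuous_on_interval a b g"
  shows "abs_continuous_on_interval a b (\<lambda>t. f t - g t)"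
  using assms by (rule abs_continuous_on_interval_dominated[where M = 1]) auto

lemma abs_continuous_on_interval_imp_continuous_on:
  assumes "abs_continuous_on_interval a b f"
  shows "continuous_on {a..b} f"
  unfolding continuous_on_iff
proof (intro ballI allI impI)
  fix s \<epsilon> :: real assume s: "s \<in> {a..b}" and "\<epsilon> > 0"
  obtain \<delta> where \<delta>: "\<delta> > 0"
    "\<forall>d. d division_of \<Union>d \<and> \<Union>d \<subseteq> {a..b} \<and> (\<Sum>k\<in>d. Sup k - Inf k) < \<delta>
        \<longrightarrow> (\<Sum>k\<in>d. \<bar>f (Sup k) - f (Inf k)\<bar>) < \<epsilon>"
    by (rule abs_continuous_on_intervalD[OF assms \<open>\<epsilon> > 0\<close>])
  have *: "\<bar>f v - f u\<bar> < \<epsilon>" if "a \<le> u" "u \<le> v" "v \<le> b" "v - u < \<delta>" for u v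
  proof -
    \<comment> \<open>Continuity needs only divisions that consist of a single interval.\<close>
    have "{{u..v}} division_of \<Union>{{u..v}}"
      using division_of_self[of u v] that by simp
    then show ?thesis using \<delta>(2)[rule_format, of "{{u..v}}"] that by simp
  qed
  show "\<exists>d>0. \<forall>t\<in>{a..b}. dist t s < d \<longrightarrow> dist (f t) (f s) < \<epsilon>"
  proof (intro exI[of _ \<delta>] conjI ballI impI)
    fix t assume t: "t \<in> {a..b}" "dist t s < \<delta>"
    show "dist (f t) (f s) < \<epsilon>"
      using *[of s t] *[of t s] s t by (cases "s \<le> t") (auto simp: dist_real_def)
  qed (fact \<delta>)
qed

lemma abs_continuous_on_interval_bounded:
  assumes "abs_continuous_on_interval a b f"
  obtains M where "M \<ge> 0" "\<forall>t\<in>{a..b}. \<bar>f t\<bar> \<le> M"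
proof -
  have "bounded (f ` {a..b})"
    using abs_continuous_on_interval_imp_continuous_on[OF assms]
    by (intro compact_imp_bounded compact_continuous_image) auto
  then obtain M where "\<forall>t\<in>{a..b}. \<bar>f t\<bar> \<le> M"
    unfolding bounded_iff by auto
  then have "\<forall>t\<in>{a..b}. \<bar>f t\<bar> \<le> \<bar>M\<bar>"
    by (meson abs_ge_self order_trans)
  then show ?thesis by (rule that[OF abs_ge_zero])
qed

lemma abs_continuous_on_interval_mult:
  assumes f: "abs_continuous_on_interval a b f" and g: "abs_continuous_on_interval a b g"
  shows "abs_continuous_on_interval a b (\<lambda>t. f t * g t)"
proof -
  obtain M where M: "M \<ge> 0" "\<forall>t\<in>{a..b}. \<bar>f t\<bar> \<le> M"
    by (rule abs_continuous_on_interval_bounded[OF f])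
  obtain N where N: "N \<ge> 0" "\<forall>t\<in>{a..b}. \<bar>g t\<bar> \<le> N"
    by (rule abs_continuous_on_interval_bounded[OF g])
  show ?thesis
  proof (rule abs_continuous_on_interval_dominated[OF f g, where M = "M + N"])
    fix u v assume uv: "a \<le> u" "u \<le> v" "v \<le> b"
    have "f v * g v - f u * g u = (f v - f u) * g u + f v * (g v - g u)"
      by (simp add: algebra_simps)
    also have "\<bar>\<dots>\<bar> \<le> \<bar>f v - f u\<bar> * \<bar>g u\<bar> + \<bar>f v\<bar> * \<bar>g v - g u\<bar>"
      by (metis abs_mult abs_triangle_ineq)
    also have "\<dots> \<le> \<bar>f v - f u\<bar> * (M + N) + (M + N) * \<bar>g v - g u\<bar>"
      using M(1) bspec[OF M(2), of v] N(1) bspec[OF N(2), of u] uv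
      by (intro add_mono mult_left_mono mult_right_mono) auto
    finally show "\<bar>f v * g v - f u * g u\<bar> \<le> (M + N) * (\<bar>f v - f u\<bar> + \<bar>g v - g u\<bar>)"
      by (simp add: algebra_simps)
  qed
qed

text \<open>A continuous derivative is bounded on the compact interval, so \<open>f\<close> is
  Lipschitz there.\<close>

lemma abs_continuous_on_interval_C1:
  assumes "\<And>t. t \<in> {a..b} \<Longrightarrow> (f has_real_derivative f' t) (at t within {a..b})"
    and "continuous_on {a..b} f'"
  shows "abs_continuous_on_interval a b f"
proof -
  have "bounded (f' ` {a..b})"
    using assms(2) by (intro compact_imp_bounded compact_continuous_image) auto
  then obtain L where L: "\<forall>t\<in>{a..b}. \<bar>f' t\<bar> \<le> L"
    unfolding bounded_iff by auto
  show ?thesis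
  proof (rule abs_continuous_on_interval_lipschitz)
    fix u v assume uv: "a \<le> u" "u \<le> v" "v \<le> b"
    have "norm (f v - f u) \<le> L * norm (v - u)"
    proof (rule field_differentiable_bound[of "{a..b}" f f'])
      show "convex {a..b}" by simp
      show "norm (f' t) \<le> L" if "t \<in> {a..b}" for t
        using bspec[OF L that] by simp
    qed (use assms(1) uv in auto)
    then show "\<bar>f v - f u\<bar> \<le> L * (v - u)" using uv by simp
  qed
qed

section \<open>Monotonicity from a derivative bound off a null set\<close>

text \<open>Outer regularity of Lebesgue measure makes \<open>T - N\<close> small, and removing the
  null set \<open>N\<close> does not change the measure of \<open>T\<close>.\<close>

lemma negligible_outer_open:
  fixes N :: "'a::euclidean_space set"
  assumes "negligible N" "\<delta> > 0"
  obtains T where "open T" "N \<subseteq> T" "T \<in> lmeasurable" "measure lebesgue T < \<delta>"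
proof -
  have N: "N \<in> null_sets lebesgue" using assms(1) by (simp add: negligible_iff_null_sets)
  then have "N \<in> sets lebesgue" by auto
  then obtain T where T: "open T" "N \<subseteq> T" "T - N \<in> lmeasurable" "emeasure lebesgue (T - N) < ennreal \<delta>"
    using sets_lebesgue_outer_open assms(2) by metis
  have "emeasure lebesgue (T - N) = emeasure lebesgue T"
    using N T(1) by (intro emeasure_Diff_null_set) auto
  then have e: "emeasure lebesgue T < ennreal \<delta>" using T(4) by simp
  then have T': "T \<in> lmeasurable" using T(1) by (intro fmeasurableI) (auto simp: top.not_eq_extremum order.strict_trans)
  then have "measure lebesgue T < \<delta>"
    using e assms(2) by (simp add: emeasure_eq_measure2 ennreal_less_iff)
  with that T T' show thesis by blast
qed

text \<open>The blocks of a division overlap in null sets only, so their lengths add up to the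
  measure of the union. This turns an open cover of small measure into the length bound that
  absolute continuity asks for.\<close>

lemma division_total_length_le:
  fixes d :: "real set set"
  assumes d: "d division_of \<Union>d" and T: "\<Union>d \<subseteq> T" "T \<in> lmeasurable"
  shows "(\<Sum>k\<in>d. Sup k - Inf k) \<le> measure lebesgue T"
proof -
  have "(\<Sum>k\<in>d. Sup k - Inf k) = (\<Sum>k\<in>d. measure lebesgue k)"
  proof (rule sum.cong[OF refl])
    fix k assume "k \<in> d"
    then obtain u v where "k = cbox u v" "k \<noteq> {}"
      using division_ofD(3,4)[OF d] by blast
    then show "Sup k - Inf k = measure lebesgue k" by auto
  qed
  also have "\<dots> = measure lebesgue (\<Union>d)"
    using content_division[OF d] .
  also have "\<dots> \<le> measure lebesgue T"
    using T lmeasurable_division[OF d] by (intro measure_mono_fmeasurable) auto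
  finally show ?thesis .
qed

text \<open>A gauge-integral argument: tags off \<open>N\<close> contribute almost nonnegative increments, while
  the intervals with tags in \<open>N\<close> lie in an open set of small measure.\<close>

lemma le_if_straddle_derivative_nonneg:
  fixes F f g :: "real \<Rightarrow> real"
  assumes "a \<le> b" and N: "negligible N"
    and f: "abs_continuous_on_interval a b f" and g: "abs_continuous_on_interval a b g"
    and der: "\<And>t e. t \<in> {a..b} - N \<Longrightarrow> e > 0 \<Longrightarrow> \<exists>\<delta>>0. \<forall>u\<in>{a..t}. \<forall>v\<in>{t..b}.
        t - \<delta> < u \<longrightarrow> v < t + \<delta> \<longrightarrow> - e * (v - u) \<le> F v - F u"
    and dom: "\<And>u v. a \<le> u \<Longrightarrow> u \<le> v \<Longrightarrow> v \<le> b \<Longrightarrow>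
        - M * (\<bar>f v - f u\<bar> + \<bar>g v - g u\<bar>) \<le> F v - F u"
  shows "F a \<le> F b"
proof (rule field_le_epsilon)
  fix e :: real assume "e > 0"
  define K where "K = \<bar>M\<bar> + 1"
  have K: "K > 0" "M \<le> K" by (auto simp: K_def)
  \<comment> \<open>Half of \<open>e\<close> is reserved for the tags off \<open>N\<close>; the
    summand 1 keeps the denominator positive when \<open>a = b\<close>.\<close>
  define e' where "e' = e / (2 * (b - a + 1))"
  have e': "e' > 0" "e' * (b - a) \<le> e / 2"
    using \<open>e > 0\<close> \<open>a \<le> b\<close> by (auto simp: e'_def field_simps)
  \<comment> \<open>The other half is for the tags in \<open>N\<close>: after multiplication by
    \<open>K\<close>, the variations of \<open>f\<close> and of \<open>g\<close> cost
    \<open>e / 4\<close> each.\<close>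
  have pos: "e / (4 * K) > 0" using \<open>e > 0\<close> K by simp
  obtain \<delta>1 where 1: "\<delta>1 > 0"
    "\<forall>d. d division_of \<Union>d \<and> \<Union>d \<subseteq> {a..b} \<and> (\<Sum>k\<in>d. Sup k - Inf k) < \<delta>1
        \<longrightarrow> (\<Sum>k\<in>d. \<bar>f (Sup k) - f (Inf k)\<bar>) < e / (4 * K)"
    by (rule abs_continuous_on_intervalD[OF f pos])
  obtain \<delta>2 where 2: "\<delta>2 > 0"
    "\<forall>d. d division_of \<Union>d \<and> \<Union>d \<subseteq> {a..b} \<and> (\<Sum>k\<in>d. Sup k - Inf k) < \<delta>2
        \<longrightarrow> (\<Sum>k\<in>d. \<bar>g (Sup k) - g (Inf k)\<bar>) < e / (4 * K)"
    by (rule abs_continuous_on_intervalD[OF g pos])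
  have "min \<delta>1 \<delta>2 > 0" using 1 2 by simp
  then obtain T where T: "open T" "N \<subseteq> T" "T \<in> lmeasurable" "measure lebesgue T < min \<delta>1 \<delta>2"
    by (rule negligible_outer_open[OF N])
  have "\<exists>\<delta>. \<forall>t\<in>{a..b} - N. \<delta> t > 0 \<and> (\<forall>u\<in>{a..t}. \<forall>v\<in>{t..b}.
        t - \<delta> t < u \<longrightarrow> v < t + \<delta> t \<longrightarrow> - e' * (v - u) \<le> F v - F u)"
    using der[OF _ e'(1)] by (intro bchoice ballI) blast
  then obtain \<delta> where \<delta>: "\<And>t. t \<in> {a..b} - N \<Longrightarrow> \<delta> t > 0"
    "\<And>t u v. t \<in> {a..b} - N \<Longrightarrow> u \<in> {a..t} \<Longrightarrow> v \<in> {t..b} \<Longrightarrow> t - \<delta> t < u \<Longrightarrow> v < t + \<delta> t \<Longrightarrow>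
        - e' * (v - u) \<le> F v - F u"
    by blast
  \<comment> \<open>Intervals tagged in \<open>N\<close> are forced into the small open set
    \<open>T\<close>, the others into the range of their straddle estimate; \<open>UNIV\<close> is a
    default for points outside \<open>{a..b}\<close>, where no tag lies.\<close>
  define \<gamma> where "\<gamma> t = (if t \<in> N then T else if t \<in> {a..b} then ball t (\<delta> t) else UNIV)" for t
  have "gauge \<gamma>"
    unfolding gauge_def \<gamma>_def using T(1,2) \<delta>(1) by auto
  then obtain p where p: "p tagged_division_of {a..b}" "\<gamma> fine p"
    by (rule fine_division_exists_real)
  have p': "p tagged_partial_division_of {a..b}" and fin: "finite p"
    using p(1) by (auto simp: tagged_division_of_def tagged_partial_division_of_def)
  define q where "q = {(x,k) \<in> p. x \<in> N}"
  have q: "q \<subseteq> p" by (auto simp: q_def)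
  have interval: "a \<le> Inf k" "Inf k \<le> x" "x \<le> Sup k" "Sup k \<le> b" "k = {Inf k..Sup k}"
    if xk: "(x,k) \<in> p" for x k
  proof -
    obtain u v where "k = cbox u v" using tagged_division_ofD(4)[OF p(1) xk] by blast
    moreover have "x \<in> k" "k \<subseteq> {a..b}" using tagged_division_ofD(2,3)[OF p(1) xk] by auto
    ultimately show "a \<le> Inf k" "Inf k \<le> x" "x \<le> Sup k" "Sup k \<le> b" "k = {Inf k..Sup k}"
      by auto
  qed
  let ?sum = "\<lambda>h s. \<Sum>(x,k)\<in>s. h k"
  have sum_len: "?sum (\<lambda>k. Sup k - Inf k) p = b - a"
    using additive_tagged_division_1[OF \<open>a \<le> b\<close> p(1), of "\<lambda>x. x"] .
  have sum_F: "?sum (\<lambda>k. F (Sup k) - F (Inf k)) p = F b - F a"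
    using additive_tagged_division_1[OF \<open>a \<le> b\<close> p(1), of F] .

  have "- (e / 2) \<le> - e' * ?sum (\<lambda>k. Sup k - Inf k) p"
    using e' sum_len by simp
  also have "\<dots> \<le> - e' * ?sum (\<lambda>k. Sup k - Inf k) (p - q)"
  proof -
    have "?sum (\<lambda>k. Sup k - Inf k) (p - q) \<le> ?sum (\<lambda>k. Sup k - Inf k) p"
      using interval by (intro sum_mono2[OF fin]) force+
    then show ?thesis using e'(1) by simp
  qed
  also have "\<dots> = (\<Sum>(x,k)\<in>p - q. - e' * (Sup k - Inf k))"
    by (simp add: sum_distrib_left case_prod_unfold)
  also have "\<dots> \<le> ?sum (\<lambda>k. F (Sup k) - F (Inf k)) (p - q)"
  proof (rule sum_mono, clarify)
    fix x k assume xk: "(x,k) \<in> p" "(x,k) \<notin> q"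
    note k = interval[OF xk(1)]
    have x: "x \<in> {a..b} - N" using xk k by (auto simp: q_def)
    have "k \<subseteq> ball x (\<delta> x)" using fineD[OF p(2) xk(1)] x by (simp add: \<gamma>_def)
    moreover have "Inf k \<in> k" "Sup k \<in> k" using k by (metis atLeastAtMost_iff order.trans order_refl)+
    ultimately have "Inf k \<in> ball x (\<delta> x)" "Sup k \<in> ball x (\<delta> x)" by blast+
    then show "- e' * (Sup k - Inf k) \<le> F (Sup k) - F (Inf k)"
      using k by (intro \<delta>(2)[OF x]) (auto simp: dist_real_def)
  qed
  finally have off: "- (e / 2) \<le> ?sum (\<lambda>k. F (Sup k) - F (Inf k)) (p - q)" .

  have qp: "q tagged_partial_division_of {a..b}"
    using tagged_partial_division_subset[OF p' q] .
  define d where "d = snd ` q"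
  have d: "d division_of \<Union>d" unfolding d_def
    using partial_division_of_tagged_division[OF qp] .
  have dsub: "\<Union>d \<subseteq> {a..b}" unfolding d_def using tagged_partial_division_ofD(3)[OF qp] by fastforce
  have "\<Union>d \<subseteq> T" using p(2) by (fastforce simp: fine_def \<gamma>_def d_def q_def)
  then have len: "(\<Sum>k\<in>d. Sup k - Inf k) < min \<delta>1 \<delta>2"
    using division_total_length_le[OF d _ T(3)] T(4) by linarith
  \<comment> \<open>Passing from tagged intervals to bare ones can merge two tags of the same
    interval. Such an interval has empty interior, so it is a point and its term vanishes.\<close>
  have sum_q: "?sum h q = sum h d" if "\<And>k. Inf k = Sup k \<Longrightarrow> h k = 0" for h :: "real set \<Rightarrow> real"
  proof -
    have "sum h (snd ` q) = sum (h \<circ> snd) q"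
    proof (rule sum.reindex_nontrivial)
      show "finite q" using fin q by (rule rev_finite_subset)
      fix y z assume yz: "y \<in> q" "z \<in> q" "y \<noteq> z" "snd y = snd z"
      obtain x k x' where xk: "y = (x,k)" "z = (x',k)" using yz(4) by (cases y; cases z) auto
      have "interior k = {}"
        using tagged_partial_division_ofD(5)[OF qp, of x k x' k] yz xk by auto
      moreover have k: "Inf k \<le> Sup k" "k = {Inf k..Sup k}"
        using interval[of x k] yz(1) xk(1) q by auto
      ultimately have "{Inf k<..<Sup k} = {}" by (metis interior_atLeastAtMost_real)
      then show "h (snd y) = 0" using that k(1) xk(1) by simp
    qed
    then show ?thesis by (simp add: d_def comp_def case_prod_unfold)
  qed
  have "?sum (\<lambda>k. F (Sup k) - F (Inf k)) q
      \<ge> (\<Sum>(x,k)\<in>q. - K * (\<bar>f (Sup k) - f (Inf k)\<bar> + \<bar>g (Sup k) - g (Inf k)\<bar>))"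
  proof (rule sum_mono, clarify)
    fix x k assume "(x,k) \<in> q"
    then have k: "a \<le> Inf k" "Inf k \<le> Sup k" "Sup k \<le> b"
      using interval q by (meson order_trans subsetD)+
    have "- K * (\<bar>f (Sup k) - f (Inf k)\<bar> + \<bar>g (Sup k) - g (Inf k)\<bar>)
        \<le> - M * (\<bar>f (Sup k) - f (Inf k)\<bar> + \<bar>g (Sup k) - g (Inf k)\<bar>)"
      using K(2) by (intro mult_right_mono) auto
    then show "- K * (\<bar>f (Sup k) - f (Inf k)\<bar> + \<bar>g (Sup k) - g (Inf k)\<bar>) \<le> F (Sup k) - F (Inf k)"
      using dom[OF k] by linarith
  qed
  moreover have "(\<Sum>(x,k)\<in>q. - K * (\<bar>f (Sup k) - f (Inf k)\<bar> + \<bar>g (Sup k) - g (Inf k)\<bar>))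
      = - K * ((\<Sum>k\<in>d. \<bar>f (Sup k) - f (Inf k)\<bar>) + (\<Sum>k\<in>d. \<bar>g (Sup k) - g (Inf k)\<bar>))"
    by (subst sum_q) (auto simp: sum_distrib_left sum.distrib distrib_left sum_negf sum_subtractf)
  moreover have "- K * (e / (4 * K) + e / (4 * K))
      \<le> - K * ((\<Sum>k\<in>d. \<bar>f (Sup k) - f (Inf k)\<bar>) + (\<Sum>k\<in>d. \<bar>g (Sup k) - g (Inf k)\<bar>))"
    using 1(2)[rule_format, of d] 2(2)[rule_format, of d] d dsub len K(1)
    by (intro mult_left_mono_neg add_mono) auto
  moreover have "- K * (e / (4 * K) + e / (4 * K)) = - (e / 2)"
    using K(1) by simp
  ultimately have on: "- (e / 2) \<le> ?sum (\<lambda>k. F (Sup k) - F (Inf k)) q" by linarith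
  have "?sum (\<lambda>k. F (Sup k) - F (Inf k)) p
      = ?sum (\<lambda>k. F (Sup k) - F (Inf k)) (p - q) + ?sum (\<lambda>k. F (Sup k) - F (Inf k)) q"
    by (rule sum.subset_diff[OF q fin])
  then show "F a \<le> F b + e" using off on sum_F by linarith
qed

section \<open>Weighted monotonicity with a jumping term\<close>

text \<open>The monotone function \<open>G\<close> may jump: only the pointwise values \<open>G t\<close> enter the
  differential inequality, since \<open>E v * G v - E u * G u \<ge> (E v - E u) * G t\<close> for \<open>u \<le> t \<le> v\<close>.\<close>

lemma weighted_sum_mono:
  fixes v G E c :: "real \<Rightarrow> real"
  assumes ab: "a \<le> b" and v: "abs_continuous_on_interval a b v" and G: "mono G"
    and E: "\<And>t. (E has_real_derivative c t * E t) (at t)" "\<And>t. E t > 0"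
    and c: "continuous_on UNIV c"
    and ae: "AE t in lebesgue. t \<in> {a<..<b} \<longrightarrow>
        (\<exists>v'. (v has_real_derivative v') (at t) \<and> - c t * (v t + G t) \<le> v')"
  shows "E a * (v a + G a) \<le> E b * (v b + G b)"
proof -
  have "continuous_on UNIV E"
    using E(1) by (meson DERIV_continuous continuous_at_imp_continuous_on)
  then have "continuous_on {a..b} (\<lambda>t. c t * E t)"
    using c by (intro continuous_intros) (auto intro: continuous_on_subset)
  then have ACE: "abs_continuous_on_interval a b E"
    using E(1) by (intro abs_continuous_on_interval_C1) (auto intro: has_field_derivative_at_within)
  have ACEv: "abs_continuous_on_interval a b (\<lambda>t. E t * v t)"
    by (rule abs_continuous_on_interval_mult[OF ACE v])
  let ?P = "\<lambda>t. \<exists>v'. (v has_real_derivative v') (at t) \<and> - c t * (v t + G t) \<le> v'"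
  obtain N where N0: "N \<in> null_sets lebesgue"
    and sub: "{t \<in> space lebesgue. \<not> (t \<in> {a<..<b} \<longrightarrow> ?P t)} \<subseteq> N"
    using ae unfolding eventually_ae_filter by (elim bexE)
  have N: "negligible N" using N0 by (simp only: negligible_iff_null_sets)
  have P: "?P t" if "t \<notin> N" "t \<in> {a<..<b}" for t
  proof (rule ccontr)
    assume "\<not> ?P t"
    with that(2) have "t \<in> {t \<in> space lebesgue. \<not> (t \<in> {a<..<b} \<longrightarrow> ?P t)}"
      by (simp only: mem_Collect_eq space_completion space_lborel space_borel) simp
    with sub that(1) show False by (meson subsetD)
  qed
  have jump: "(E w - E u) * G t \<le> E w * G w - E u * G u" if "u \<le> t" "t \<le> w" for u t w
  proof -
    have "E u * G u \<le> E u * G t" "E w * G t \<le> E w * G w"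
      using that monoD[OF G] less_imp_le[OF E(2)] by (auto intro!: mult_left_mono)
    then show ?thesis by (simp add: algebra_simps)
  qed
  \<comment> \<open>The variation is controlled by that of \<open>E * v\<close> and of
    \<open>E\<close>. The endpoints join the exceptional set because the differential inequality is
    given on the open interval.\<close>
  show ?thesis
  proof (rule le_if_straddle_derivative_nonneg[OF ab _ ACEv ACE,
        where F = "\<lambda>t. E t * (v t + G t)" and N = "insert a (insert b N)" and M = "1 + \<bar>G a\<bar> + \<bar>G b\<bar>"])
    show "negligible (insert a (insert b N))" using N by simp
  next
    fix t e :: real assume t: "t \<in> {a..b} - insert a (insert b N)" and "e > 0"
    then obtain v' where v': "(v has_real_derivative v') (at t)" "- c t * (v t + G t) \<le> v'"
      using P[of t] by auto
    \<comment> \<open>Freezing \<open>G\<close> at its value at \<open>t\<close> gives a function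
      differentiable at \<open>t\<close>; its derivative \<open>D\<close> is \<open>E t\<close>
      times the slack in the differential inequality.\<close>
    define H where "H s = E s * (v s + G t)" for s
    define D where "D = c t * E t * (v t + G t) + E t * v'"
    have "(H has_real_derivative D) (at t)"
      unfolding H_def D_def by (auto intro!: derivative_eq_intros E v' simp: algebra_simps)
    then have "\<forall>e>0. \<exists>\<delta>>0. \<forall>s. norm (s - t) < \<delta> \<longrightarrow> norm (H s - H t - D * (s - t)) \<le> e * norm (s - t)"
      unfolding has_field_derivative_def has_derivative_at_alt by (rule conjunct2)
    from this[THEN spec, THEN mp, OF \<open>e > 0\<close>]
    obtain \<delta> where \<delta>: "\<delta> > 0" "\<forall>s. \<bar>s - t\<bar> < \<delta> \<longrightarrow> \<bar>H s - H t - D * (s - t)\<bar> \<le> e * \<bar>s - t\<bar>"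
      unfolding real_norm_def by (elim exE conjE)
    have "D = E t * (v' - (- c t * (v t + G t)))" by (simp add: D_def algebra_simps)
    then have D: "D \<ge> 0" using v'(2) E(2)[of t] by simp
    show "\<exists>\<delta>>0. \<forall>u\<in>{a..t}. \<forall>w\<in>{t..b}. t - \<delta> < u \<longrightarrow> w < t + \<delta> \<longrightarrow>
        - e * (w - u) \<le> E w * (v w + G w) - E u * (v u + G u)"
    proof (intro exI[of _ \<delta>] conjI ballI impI)
      fix u w assume u: "u \<in> {a..t}" and w: "w \<in> {t..b}" and near: "t - \<delta> < u" "w < t + \<delta>"
      have "\<bar>H w - H t - D * (w - t)\<bar> \<le> e * (w - t)" using \<delta>(2)[rule_format, of w] w near by auto
      moreover have "0 \<le> D * (w - t)" using D w by auto
      moreover have "\<bar>H u - H t - D * (u - t)\<bar> \<le> e * (t - u)" using \<delta>(2)[rule_format, of u] u near by auto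
      moreover have "D * (u - t) \<le> 0" using D u by (auto intro!: mult_nonneg_nonpos)
      ultimately have "- (e * (w - t)) - e * (t - u) \<le> H w - H u" by linarith
      moreover have "- (e * (w - t)) - e * (t - u) = - e * (w - u)" by (simp add: algebra_simps)
      moreover have "H w - H u \<le> E w * (v w + G w) - E u * (v u + G u)"
        using jump[of u t w] u w by (simp add: H_def algebra_simps)
      ultimately show "- e * (w - u) \<le> E w * (v w + G w) - E u * (v u + G u)" by linarith
    qed (fact \<delta>)
  next
    \<comment> \<open>At exceptional tags only a lower bound on the increment is sought: the jumps
      of \<open>G\<close> are upward, and \<open>G\<close> is bounded on \<open>{a..b}\<close> by
      its endpoint values.\<close>
    fix u w assume uw: "a \<le> u" "u \<le> w" "w \<le> b"
    have "G a \<le> G u" "G u \<le> G b" using monoD[OF G] uw by auto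
    then have Gu: "\<bar>G u\<bar> \<le> 1 + \<bar>G a\<bar> + \<bar>G b\<bar>" by linarith
    define M where "M = 1 + \<bar>G a\<bar> + \<bar>G b\<bar>"
    have M: "\<bar>G u\<bar> \<le> M" "1 \<le> M" using Gu by (auto simp: M_def)
    define e where "e = \<bar>E w - E u\<bar>"
    define h where "h = \<bar>E w * v w - E u * v u\<bar>"
    have "\<bar>(E w - E u) * G u\<bar> \<le> M * e"
      using mult_right_mono[OF M(1), of e] by (simp add: e_def abs_mult mult.commute)
    then have "- (M * e) \<le> (E w - E u) * G u" by linarith
    also have "\<dots> \<le> E w * G w - E u * G u" using jump[of u u w] uw by simp
    finally have "- (M * e) \<le> E w * G w - E u * G u" .
    moreover have "- (M * h) \<le> E w * v w - E u * v u"
    proof -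
      have "1 * h \<le> M * h" using M(2) by (intro mult_right_mono) (simp_all add: h_def)
      moreover have "- h \<le> E w * v w - E u * v u" unfolding h_def by linarith
      ultimately show ?thesis by linarith
    qed
    ultimately have "- M * (h + e) \<le> E w * (v w + G w) - E u * (v u + G u)"
      by (simp add: algebra_simps)
    then show "- (1 + \<bar>G a\<bar> + \<bar>G b\<bar>) * (\<bar>E w * v w - E u * v u\<bar> + \<bar>E w - E u\<bar>)
        \<le> E w * (v w + G w) - E u * (v u + G u)"
      by (simp only: M_def h_def e_def)
  qed
qed

section \<open>Integrating factors and confinement of bounded solutions\<close>

lemma real_antiderivative:
  fixes c :: "real \<Rightarrow> real"
  assumes "continuous_on UNIV c"
  obtains C where "\<forall>t. (C has_real_derivative c t) (at t)"
proof -
  have "isCont c t" for t using assms by (simp add: continuous_on_eq_continuous_at)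
  then have "\<exists>C. \<forall>t::real. -\<infinity> < ereal t \<longrightarrow> ereal t < \<infinity> \<longrightarrow> (C has_vector_derivative c t) (at t)"
    by (intro einterval_antiderivative) auto
  then show ?thesis using that by (auto simp: has_real_derivative_iff_has_vector_derivative)
qed

text \<open>This translates the exponential dichotomy estimates, stated with integrals, into
  quotients of integrating factors.\<close>

lemma LBINT_eq_diff_antiderivative:
  fixes c C :: "real \<Rightarrow> real"
  assumes "continuous_on UNIV c" "\<And>t. (C has_real_derivative c t) (at t)"
  shows "(LBINT l=ereal s..ereal t. c l) = C t - C s"
  using assms by (intro interval_integral_FTC_finite)
    (auto intro: continuous_on_subset has_vector_derivative_at_within
          simp: has_real_derivative_iff_has_vector_derivative)

lemma caratheodory_solution_continuous:
  assumes "caratheodory_solution f x"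
  shows "continuous_on UNIV x"
proof -
  have "isCont x t" for t
  proof (rule continuous_on_interior)
    show "continuous_on {t - 1..t + 1} x"
      using assms abs_continuous_on_interval_imp_continuous_on
      unfolding caratheodory_solution_def by blast
  qed simp
  then show ?thesis by (simp add: continuous_at_imp_continuous_on)
qed

text \<open>Put \<open>w = y + G - x\<close>. Apart from the increase of \<open>G\<close>, its
  derivative is \<open>- 2 * y * w + w\<^sup>2\<close>. The square is nonnegative, and
  \<open>exp Y\<close> is the integrating factor of the linear part.\<close>

lemma riccati_weighted_mono:
  assumes y: "caratheodory_solution (\<lambda>t y. - y\<^sup>2 + p t) y"
    and x: "caratheodory_solution (\<lambda>t x. - (x - G t)\<^sup>2 + p t) x"
    and G: "mono G" and Y: "\<And>t. (Y has_real_derivative 2 * y t) (at t)" and "s \<le> t"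
  shows "exp (Y s) * (y s + G s - x s) \<le> exp (Y t) * (y t + G t - x t)"
proof -
  have "exp (Y s) * ((y s - x s) + G s) \<le> exp (Y t) * ((y t - x t) + G t)"
  proof (rule weighted_sum_mono[OF \<open>s \<le> t\<close> _ G, where c = "\<lambda>t. 2 * y t"])
    show "abs_continuous_on_interval s t (\<lambda>t. y t - x t)"
      using x y by (intro abs_continuous_on_interval_diff) (auto simp: caratheodory_solution_def)
    show "((\<lambda>t. exp (Y t)) has_real_derivative 2 * y t * exp (Y t)) (at t)" for t
      by (auto intro!: derivative_eq_intros Y)
    show "continuous_on UNIV (\<lambda>t. 2 * y t)"
      using caratheodory_solution_continuous[OF y] by (intro continuous_intros)
    have "AE t in lebesgue. (y has_real_derivative - (y t)\<^sup>2 + p t) (at t)"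
      "AE t in lebesgue. (x has_real_derivative - (x t - G t)\<^sup>2 + p t) (at t)"
      using x y by (auto simp: caratheodory_solution_def)
    then show "AE \<tau> in lebesgue. \<tau> \<in> {s<..<t} \<longrightarrow>
        (\<exists>v'. ((\<lambda>t. y t - x t) has_real_derivative v') (at \<tau>) \<and> - (2 * y \<tau>) * ((y \<tau> - x \<tau>) + G \<tau>) \<le> v')"
    proof eventually_elim
      case (elim \<tau>)
      have "((\<lambda>t. y t - x t) has_real_derivative
          (- (y \<tau>)\<^sup>2 + p \<tau>) - (- (x \<tau> - G \<tau>)\<^sup>2 + p \<tau>)) (at \<tau>)"
        using elim by (intro DERIV_diff) auto
      moreover have "(- (y \<tau>)\<^sup>2 + p \<tau>) - (- (x \<tau> - G \<tau>)\<^sup>2 + p \<tau>)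
          = - (2 * y \<tau>) * ((y \<tau> - x \<tau>) + G \<tau>) + ((y \<tau> - x \<tau>) + G \<tau>)\<^sup>2"
        by (simp add: power2_eq_square algebra_simps)
      ultimately show ?case by (metis le_add_same_cancel1 zero_le_power2)
    qed
  qed simp
  then show ?thesis by (simp add: algebra_simps)
qed

lemma nonpos_if_le_exp_decay:
  fixes z C \<beta> :: real
  assumes "\<beta> > 0" "\<And>\<tau>. \<tau> \<ge> 0 \<Longrightarrow> z \<le> C * exp (- \<beta> * \<tau>)"
  shows "z \<le> 0"
proof (rule ccontr)
  assume "\<not> z \<le> 0"
  then have z: "z > 0" by simp
  have C: "C > 0" using assms(2)[of 0] z by simp
  \<comment> \<open>Chosen so that \<open>exp (\<beta> * \<tau>) \<ge> 1 + C / z\<close>, which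
    already exceeds the permitted \<open>C / z\<close>; no limit has to be taken.\<close>
  define \<tau> where "\<tau> = C / (z * \<beta>)"
  have \<tau>: "\<tau> \<ge> 0" "\<beta> * \<tau> = C / z" using z C assms(1) by (auto simp: \<tau>_def)
  have "C / z < exp (\<beta> * \<tau>)" using exp_ge_add_one_self[of "\<beta> * \<tau>"] \<tau>(2) by linarith
  then have "C < z * exp (\<beta> * \<tau>)" using z by (simp add: field_simps)
  moreover have "z * exp (\<beta> * \<tau>) \<le> C"
    using assms(2)[OF \<tau>(1)] by (simp add: exp_minus field_simps)
  ultimately show False by simp
qed

text \<open>Weighted comparison transports a violation of either bound towards infinity, where
  boundedness limits its size; the dichotomy makes the ratio of the weights decay, so there is no
  violation at \<open>t\<close>.\<close>

lemma bounded_solution_shift_bounds: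
  assumes a: "caratheodory_solution (\<lambda>t y. - y\<^sup>2 + p t) a" and r: "caratheodory_solution (\<lambda>t y. - y\<^sup>2 + p t) r"
    and ba: "bounded (range a)" and br: "bounded (range r)"
    and x: "bounded_solution (\<lambda>t x. - (x - G t)\<^sup>2 + p t) x"
    and G: "mono G" "bounded (range G)" and \<beta>: "\<beta> > 0"
    and ha: "\<And>s t. s \<le> t \<Longrightarrow> exp (LBINT l=ereal s..ereal t. - 2 * a l) \<le> k * exp (- \<beta> * (t - s))"
    and hr: "\<And>s t. t \<le> s \<Longrightarrow> exp (LBINT l=ereal s..ereal t. - 2 * r l) \<le> k * exp (\<beta> * (t - s))"
  shows "r t \<le> x t - G t" "x t - G t \<le> a t"
proof -
  have x': "caratheodory_solution (\<lambda>t x. - (x - G t)\<^sup>2 + p t) x" and bx: "bounded (range x)"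
    using x by (auto simp: bounded_solution_def)
  have "\<exists>B. \<forall>t. \<bar>y t\<bar> \<le> B" if "bounded (range y)" for y :: "real \<Rightarrow> real"
    using that by (simp add: bounded_iff)
  then obtain Ba Br Bx BG where bounds: "\<forall>t. \<bar>a t\<bar> \<le> Ba" "\<forall>t. \<bar>r t\<bar> \<le> Br"
      "\<forall>t. \<bar>x t\<bar> \<le> Bx" "\<forall>t. \<bar>G t\<bar> \<le> BG"
    using ba br bx G(2) by metis
  have ca: "continuous_on UNIV (\<lambda>t. 2 * a t)" and cr: "continuous_on UNIV (\<lambda>t. 2 * r t)"
    using caratheodory_solution_continuous[OF a] caratheodory_solution_continuous[OF r]
    by (auto intro!: continuous_intros)
  have LBINT: "(LBINT l=ereal s..ereal t. - 2 * y l) = Y s - Y t"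
    if "continuous_on UNIV (\<lambda>t. 2 * y t)" "\<And>t. (Y has_real_derivative 2 * y t) (at t)" for y Y s t
  proof -
    have "(LBINT l=ereal s..ereal t. - (2 * y l)) = (- Y t) - (- Y s)"
      using that by (intro LBINT_eq_diff_antiderivative) (auto intro!: continuous_on_minus DERIV_minus)
    then show ?thesis by simp
  qed
  \<comment> \<open>The comparison runs forwards from \<open>t\<close> to \<open>t + \<tau>\<close>;
    the repulsion estimate is used on the integral oriented from \<open>t + \<tau>\<close> back to
    \<open>t\<close>.\<close>
  have "r t + G t - x t \<le> 0"
  proof (rule nonpos_if_le_exp_decay[OF \<beta>])
    fix \<tau> :: real assume "\<tau> \<ge> 0"
    obtain R where R: "\<forall>t. (R has_real_derivative 2 * r t) (at t)"
      by (rule real_antiderivative[OF cr])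
    have "exp (R t) * (r t + G t - x t) \<le> exp (R (t + \<tau>)) * (r (t + \<tau>) + G (t + \<tau>) - x (t + \<tau>))"
      using riccati_weighted_mono[OF r x' G(1) R[rule_format]] \<open>\<tau> \<ge> 0\<close> by simp
    also have "\<dots> \<le> exp (R (t + \<tau>)) * (Br + BG + Bx)"
      using bounds[THEN spec, of "t + \<tau>"] by (intro mult_left_mono) auto
    finally have "r t + G t - x t \<le> exp (R (t + \<tau>) - R t) * (Br + BG + Bx)"
      by (simp add: exp_diff field_simps)
    also have "\<dots> \<le> k * exp (- \<beta> * \<tau>) * (Br + BG + Bx)"
      using hr[of t "t + \<tau>"] \<open>\<tau> \<ge> 0\<close> bounds[THEN spec, of t] LBINT[OF cr R[rule_format]] by (intro mult_right_mono) auto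
    finally show "r t + G t - x t \<le> k * (Br + BG + Bx) * exp (- \<beta> * \<tau>)"
      by (simp add: mult_ac)
  qed
  then show "r t \<le> x t - G t" by simp
  \<comment> \<open>The comparison now starts in the past at \<open>t - \<tau>\<close>, and the
    attraction of \<open>a\<close> supplies the decay.\<close>
  have "x t - G t - a t \<le> 0"
  proof (rule nonpos_if_le_exp_decay[OF \<beta>])
    fix \<tau> :: real assume "\<tau> \<ge> 0"
    obtain A where A: "\<forall>t. (A has_real_derivative 2 * a t) (at t)"
      by (rule real_antiderivative[OF ca])
    have "exp (A (t - \<tau>)) * (a (t - \<tau>) + G (t - \<tau>) - x (t - \<tau>)) \<le> exp (A t) * (a t + G t - x t)"
      using riccati_weighted_mono[OF a x' G(1) A[rule_format]] \<open>\<tau> \<ge> 0\<close> by simp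
    then have "exp (A t) * (x t - G t - a t) \<le> exp (A (t - \<tau>)) * (x (t - \<tau>) - G (t - \<tau>) - a (t - \<tau>))"
      by (simp add: algebra_simps)
    also have "\<dots> \<le> exp (A (t - \<tau>)) * (Bx + BG + Ba)"
      using bounds[THEN spec, of "t - \<tau>"] by (intro mult_left_mono) auto
    finally have "x t - G t - a t \<le> exp (A (t - \<tau>) - A t) * (Bx + BG + Ba)"
      by (simp add: exp_diff field_simps)
    also have "\<dots> \<le> k * exp (- \<beta> * \<tau>) * (Bx + BG + Ba)"
      using ha[of "t - \<tau>" t] \<open>\<tau> \<ge> 0\<close> bounds[THEN spec, of t] LBINT[OF ca A[rule_format]] by (intro mult_right_mono) auto
    finally show "x t - G t - a t \<le> k * (Bx + BG + Ba) * exp (- \<beta> * \<tau>)"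
      by (simp add: mult_ac)
  qed
  then show "x t - G t \<le> a t" by simp
qed

section \<open>Monotonicity, sampling and boundedness of the discretized
  \<open>\<Gamma>\<close>\<close>

lemma piecewise_const_mono:
  assumes "mono \<Gamma>" "h \<ge> 0"
  shows "mono (piecewise_const \<Gamma> h)"
proof (rule monoI)
  fix s t :: real assume "s \<le> t"
  have "of_int \<lfloor>s / h\<rfloor> * h \<le> of_int \<lfloor>t / h\<rfloor> * h" if "h > 0"
    using that \<open>s \<le> t\<close> by (intro mult_right_mono) (auto intro!: floor_mono divide_right_mono)
  then show "piecewise_const \<Gamma> h s \<le> piecewise_const \<Gamma> h t"
    using monoD[OF assms(1)] \<open>s \<le> t\<close> assms(2) by (auto simp: piecewise_const_def)
qed

text \<open>The witness is the last grid point up to \<open>t\<close>, or \<open>t\<close> itself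
  when \<open>h = 0\<close>. Sampling always looks to the left, so for monotone
  \<open>\<Gamma>\<close> the error is one-sided.\<close>

lemma piecewise_const_eq_near:
  assumes "h \<ge> 0"
  obtains s where "t - h \<le> s" "s \<le> t" "piecewise_const \<Gamma> h t = \<Gamma> s"
proof (cases "h = 0")
  case True
  then show ?thesis by (intro that[of t]) (auto simp: piecewise_const_def)
next
  case False
  then have h: "h > 0" using assms by simp
  have "of_int \<lfloor>t / h\<rfloor> * h \<le> t / h * h" "(t / h - 1) * h \<le> of_int \<lfloor>t / h\<rfloor> * h"
    using h by (intro mult_right_mono; linarith)+
  then have "of_int \<lfloor>t / h\<rfloor> * h \<le> t" "t - h \<le> of_int \<lfloor>t / h\<rfloor> * h"
    using h by (auto simp: left_diff_distrib)
  then show ?thesis using False by (intro that) (auto simp: piecewise_const_def)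
qed

lemma piecewise_const_bounded:
  assumes "bounded (range \<Gamma>)" "h \<ge> 0"
  shows "bounded (range (piecewise_const \<Gamma> h))"
proof -
  have "range (piecewise_const \<Gamma> h) \<subseteq> range \<Gamma>" by (auto simp: piecewise_const_def)
  then show ?thesis using assms(1) bounded_subset by blast
qed

section \<open>The strict supersolution and its gap\<close>

text \<open>The segment from \<open>a t\<^sub>1\<close> down to \<open>r t\<^sub>2\<close>, seen in the moving frame of \<open>\<Gamma>\<close>, is the
  graph of the strict supersolution \<open>q + \<Gamma>\<close> with \<open>q = r + \<theta> (a - r)\<close> and \<open>\<theta> t = (t\<^sub>2 - t) / (t\<^sub>2 - t\<^sub>1)\<close>;
  the solution \<open>x\<close> falls behind it at rate \<open>\<kappa>\<close>.\<close>

lemma supersolution_gap: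
  assumes a: "caratheodory_solution (\<lambda>t y. - y\<^sup>2 + p t) a"
    and r: "caratheodory_solution (\<lambda>t y. - y\<^sup>2 + p t) r"
    and x: "caratheodory_solution (\<lambda>t x. - (x - G t)\<^sup>2 + p t) x"
    and t12: "t\<^sub>1 < t\<^sub>2"
    and \<Gamma>: "\<And>t. t \<in> {t\<^sub>1..t\<^sub>2} \<Longrightarrow> (\<Gamma> has_real_derivative \<Gamma>' t) (at t within {t\<^sub>1..t\<^sub>2})"
    and \<Gamma>': "continuous_on {t\<^sub>1..t\<^sub>2} \<Gamma>'"
    and gap: "\<And>t. t \<in> {t\<^sub>1..t\<^sub>2} \<Longrightarrow>
           (1 / 4 - (t\<^sub>1 + t\<^sub>2 - 2 * t)\<^sup>2 / (4 * (t\<^sub>2 - t\<^sub>1)\<^sup>2)) * (a t - r t)\<^sup>2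
             + 1 / (t\<^sub>2 - t\<^sub>1) * (a t - r t) + \<epsilon> \<le> \<Gamma>' t"
    and G: "\<And>t. t \<in> {t\<^sub>1..t\<^sub>2} \<Longrightarrow> G t \<le> \<Gamma> t \<and> \<Gamma> t \<le> G t + \<delta>"
    and M: "\<And>t. \<bar>a t\<bar> \<le> M" "\<And>t. \<bar>r t\<bar> \<le> M"
    and \<kappa>: "\<kappa> \<ge> 0" "2 * M * \<delta> + \<kappa> * (1 + 2 * M * (t\<^sub>2 - t\<^sub>1)) \<le> \<epsilon>"
    and ends: "x t\<^sub>1 - G t\<^sub>1 \<le> a t\<^sub>1" "r t\<^sub>2 \<le> x t\<^sub>2 - G t\<^sub>2"
  shows "\<kappa> * (t\<^sub>2 - t\<^sub>1) \<le> \<delta>"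
proof -
  define T where "T = t\<^sub>2 - t\<^sub>1"
  have T: "T > 0" using t12 by (simp add: T_def)
  define \<theta> where "\<theta> t = (t\<^sub>2 - t) / T" for t
  define q where "q t = r t + \<theta> t * (a t - r t)" for t
  \<comment> \<open>Height of the supersolution above \<open>x\<close>, minus the gap that should
    have accumulated since \<open>t\<^sub>1\<close>.\<close>
  define v where "v t = q t + \<Gamma> t - x t - \<kappa> * (t - t\<^sub>1)" for t
  have \<theta>_deriv: "(\<theta> has_real_derivative - (1 / T)) (at t within S)" for t S
    unfolding \<theta>_def using T by (auto intro!: derivative_eq_intros)
  have \<theta>_range: "0 \<le> \<theta> t" "\<theta> t \<le> 1" if "t \<in> {t\<^sub>1..t\<^sub>2}" for t
    using that T by (auto simp: \<theta>_def T_def)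
  have q_bound: "\<bar>q t\<bar> \<le> M" if "t \<in> {t\<^sub>1..t\<^sub>2}" for t
  proof -
    have "q t = (1 - \<theta> t) * r t + \<theta> t * a t" by (simp add: q_def algebra_simps)
    also have "\<bar>\<dots>\<bar> \<le> (1 - \<theta> t) * \<bar>r t\<bar> + \<theta> t * \<bar>a t\<bar>"
      using \<theta>_range[OF that] abs_triangle_ineq[of "(1 - \<theta> t) * r t" "\<theta> t * a t"] by (simp add: abs_mult)
    also have "\<dots> \<le> (1 - \<theta> t) * M + \<theta> t * M"
      using \<theta>_range[OF that] M by (intro add_mono mult_left_mono) auto
    finally show ?thesis by (simp add: algebra_simps)
  qed
  have "continuous_on UNIV q"
    using caratheodory_solution_continuous[OF a] caratheodory_solution_continuous[OF r]
    unfolding q_def \<theta>_def divide_inverse by (intro continuous_intros)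
  then have cq: "continuous_on UNIV (\<lambda>t. 2 * q t)" by (intro continuous_intros)
  obtain Q where Q: "\<forall>t. (Q has_real_derivative 2 * q t) (at t)"
    by (rule real_antiderivative[OF cq])
  \<comment> \<open>The monotone term is zero here: \<open>v\<close> contains the differentiable
    \<open>\<Gamma>\<close>, and the possibly jumping \<open>G\<close> enters only through the
    derivative of \<open>x\<close>.\<close>
  have "exp (Q t\<^sub>1) * (v t\<^sub>1 + 0) \<le> exp (Q t\<^sub>2) * (v t\<^sub>2 + 0)"
  proof (rule weighted_sum_mono[OF less_imp_le[OF t12], where c = "\<lambda>t. 2 * q t" and G = "\<lambda>_. 0"])
    have ac: "abs_continuous_on_interval t\<^sub>1 t\<^sub>2 a" "abs_continuous_on_interval t\<^sub>1 t\<^sub>2 r"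
        "abs_continuous_on_interval t\<^sub>1 t\<^sub>2 x"
      using a r x by (auto simp: caratheodory_solution_def)
    have ac\<theta>: "abs_continuous_on_interval t\<^sub>1 t\<^sub>2 \<theta>"
      using \<theta>_deriv by (rule abs_continuous_on_interval_C1) simp
    have ac\<Gamma>: "abs_continuous_on_interval t\<^sub>1 t\<^sub>2 \<Gamma>"
      using \<Gamma> \<Gamma>' by (rule abs_continuous_on_interval_C1)
    have ac\<kappa>: "abs_continuous_on_interval t\<^sub>1 t\<^sub>2 (\<lambda>t. \<kappa> * (t - t\<^sub>1))"
      by (rule abs_continuous_on_interval_C1[where f' = "\<lambda>_. \<kappa>"])
         (auto intro!: derivative_eq_intros)
    show "abs_continuous_on_interval t\<^sub>1 t\<^sub>2 v"
      unfolding v_def q_def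
      by (intro abs_continuous_on_interval_add abs_continuous_on_interval_diff
                abs_continuous_on_interval_mult ac ac\<theta> ac\<Gamma> ac\<kappa>)
    show "mono (\<lambda>_::real. 0::real)" by (simp add: mono_def)
    show "((\<lambda>t. exp (Q t)) has_real_derivative 2 * q t * exp (Q t)) (at t)" for t
      by (auto intro!: derivative_eq_intros Q[rule_format])
    show "continuous_on UNIV (\<lambda>t. 2 * q t)" by (rule cq)
    have "AE t in lebesgue. (a has_real_derivative - (a t)\<^sup>2 + p t) (at t)"
      "AE t in lebesgue. (r has_real_derivative - (r t)\<^sup>2 + p t) (at t)"
      "AE t in lebesgue. (x has_real_derivative - (x t - G t)\<^sup>2 + p t) (at t)"
      using a r x by (auto simp: caratheodory_solution_def)
    then show "AE t in lebesgue. t \<in> {t\<^sub>1<..<t\<^sub>2} \<longrightarrow>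
        (\<exists>v'. (v has_real_derivative v') (at t) \<and> - (2 * q t) * (v t + 0) \<le> v')"
    proof eventually_elim
      case (elim t)
      show ?case
      proof (intro impI exI conjI)
        assume t: "t \<in> {t\<^sub>1<..<t\<^sub>2}"
        then have t': "t \<in> {t\<^sub>1..t\<^sub>2}" by auto
        define d where "d = a t - r t"
        define q' where "q' = (- (r t)\<^sup>2 + p t) + ((- (a t)\<^sup>2 + p t) - (- (r t)\<^sup>2 + p t)) * \<theta> t - d / T"
        have "(\<Gamma> has_real_derivative \<Gamma>' t) (at t)"
          using \<Gamma>[OF t'] t by (simp add: at_within_Icc_at)
        then show "(v has_real_derivative q' + \<Gamma>' t - (- (x t - G t)\<^sup>2 + p t) - \<kappa>) (at t)"
          unfolding v_def q_def q'_def d_def using elim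
          by (auto intro!: derivative_eq_intros \<theta>_deriv simp: algebra_simps diff_divide_distrib)
        \<comment> \<open>The product \<open>\<theta> t * (1 - \<theta> t) * d\<^sup>2\<close> is
          the variance term: the convex combination of the squares of \<open>r t\<close> and
          \<open>a t\<close> minus the square of \<open>q t\<close>. The last term comes from the
          slope of \<theta>.\<close>
        have q': "q' = - (q t)\<^sup>2 + p t - \<theta> t * (1 - \<theta> t) * d\<^sup>2 - d / T"
        proof -
          have "a t = r t + d" by (simp add: d_def)
          then show ?thesis
            by (simp add: q'_def q_def power2_eq_square algebra_simps)
        qed
        have "1 / 4 - (t\<^sub>1 + t\<^sub>2 - 2 * t)\<^sup>2 / (4 * (t\<^sub>2 - t\<^sub>1)\<^sup>2) = \<theta> t * (1 - \<theta> t)"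
        proof -
          have "\<theta> t * (1 - \<theta> t) = (t\<^sub>2 - t) * (t - t\<^sub>1) / T\<^sup>2"
            using T by (simp add: \<theta>_def T_def field_simps power2_eq_square)
          moreover have "1 / 4 - (t\<^sub>1 + t\<^sub>2 - 2 * t)\<^sup>2 / (4 * T\<^sup>2) = (T\<^sup>2 - (t\<^sub>1 + t\<^sub>2 - 2 * t)\<^sup>2) / (4 * T\<^sup>2)"
            using T by (simp add: diff_divide_distrib)
          moreover have "T\<^sup>2 - (t\<^sub>1 + t\<^sub>2 - 2 * t)\<^sup>2 = 4 * ((t\<^sub>2 - t) * (t - t\<^sub>1))"
            by (simp add: T_def power2_eq_square algebra_simps)
          ultimately show ?thesis by (simp add: T_def)
        qed
        then have gap': "\<theta> t * (1 - \<theta> t) * d\<^sup>2 + d / T + \<epsilon> \<le> \<Gamma>' t"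
          using gap[OF t'] by (simp add: d_def T_def)
        \<comment> \<open>Then \<open>v t = u + g - \<kappa> * (t - t\<^sub>1)\<close>, with
          \<open>g\<close> the error of replacing \<open>\<Gamma>\<close> by \<open>G\<close>. In
          the derivative of \<open>v\<close> plus \<open>2 * q t * v t\<close>, the linear terms in
          \<open>u\<close> cancel and leave \<open>u\<^sup>2\<close>.\<close>
        define u where "u = q t - (x t - G t)"
        define g where "g = \<Gamma> t - G t"
        have g: "0 \<le> g" "g \<le> \<delta>" using G[OF t'] by (auto simp: g_def)
        have "\<bar>q t * g\<bar> \<le> M * \<delta>"
          unfolding abs_mult using q_bound[OF t'] g M(1)[of t] by (intro mult_mono) auto
        then have qg: "- (M * \<delta>) \<le> q t * g" by linarith
        have "\<bar>q t * (\<kappa> * (t - t\<^sub>1))\<bar> \<le> M * (\<kappa> * T)"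
          unfolding abs_mult using q_bound[OF t'] \<kappa>(1) t T M(1)[of t]
          by (intro mult_mono) (auto simp: T_def)
        then have q\<kappa>: "q t * (\<kappa> * (t - t\<^sub>1)) \<le> M * (\<kappa> * T)" by linarith
        have "(q' + \<Gamma>' t - (- (x t - G t)\<^sup>2 + p t) - \<kappa>) + 2 * q t * (v t + 0)
            = u\<^sup>2 + (\<Gamma>' t - \<theta> t * (1 - \<theta> t) * d\<^sup>2 - d / T) + 2 * (q t * g) - 2 * (q t * (\<kappa> * (t - t\<^sub>1))) - \<kappa>"
          unfolding q' u_def g_def v_def by (simp add: power2_eq_square algebra_simps)
        \<comment> \<open>The strictness \<epsilon> has to pay for the error \<open>g\<close>, for
          the weighted accumulated gap and for its rate \<kappa>.\<close>
        also have "\<dots> \<ge> 0 + \<epsilon> - 2 * (M * \<delta>) - 2 * (M * (\<kappa> * T)) - \<kappa>"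
          using qg q\<kappa> gap' zero_le_power2[of u] by linarith
        moreover have "0 + \<epsilon> - 2 * (M * \<delta>) - 2 * (M * (\<kappa> * T)) - \<kappa> \<ge> 0"
          using \<kappa>(2) by (simp add: T_def algebra_simps)
        ultimately show "- (2 * q t) * (v t + 0) \<le> q' + \<Gamma>' t - (- (x t - G t)\<^sup>2 + p t) - \<kappa>"
          by linarith
      qed
    qed
  qed simp
  \<comment> \<open>The end values \<open>\<theta> t\<^sub>1 = 1\<close> and
    \<open>\<theta> t\<^sub>2 = 0\<close> turn \<open>q\<close> into \<open>a\<close> at the start
    and into \<open>r\<close> at the end, where the bounds on \<open>x\<close> apply.\<close>
  moreover have "0 \<le> v t\<^sub>1"
    using ends(1) G[of t\<^sub>1] t12 T by (simp add: v_def q_def \<theta>_def T_def)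
  ultimately have "0 \<le> exp (Q t\<^sub>2) * v t\<^sub>2"
    by (metis add_0_right exp_ge_zero mult_nonneg_nonneg order_trans)
  then have "0 \<le> v t\<^sub>2" by (simp add: zero_le_mult_iff)
  moreover have "v t\<^sub>2 \<le> \<delta> - \<kappa> * (t\<^sub>2 - t\<^sub>1)"
    using ends(2) G[of t\<^sub>2] t12 T by (simp add: v_def q_def \<theta>_def T_def)
  ultimately show ?thesis by linarith
qed

section \<open>Choice of constants and the contradiction\<close>

theorem theorem6p9:
  fixes p \<Gamma> a r :: "real \<Rightarrow> real" and t\<^sub>1 t\<^sub>2 :: real
  assumes "L_infinity p"
    and "attractor_repeller_pair p a r"
    and "bounded (range \<Gamma>)"
    and "continuous_on UNIV \<Gamma>"
    and "\<exists>L. (\<Gamma> \<longlongrightarrow> L) at_bot"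
    and "\<exists>L. (\<Gamma> \<longlongrightarrow> L) at_top"
    and "mono \<Gamma>"
    and "t\<^sub>1 < t\<^sub>2"
    and "C2_on {t\<^sub>1..t\<^sub>2} \<Gamma>"
    and "\<forall>t\<in>{t\<^sub>1..t\<^sub>2}.
           (1 / 4 - (t\<^sub>1 + t\<^sub>2 - 2 * t)\<^sup>2 / (4 * (t\<^sub>2 - t\<^sub>1)\<^sup>2)) * (a t - r t)\<^sup>2
             + 1 / (t\<^sub>2 - t\<^sub>1) * (a t - r t)
           < vector_derivative \<Gamma> (at t within {t\<^sub>1..t\<^sub>2})"
  shows "\<exists>h\<^sub>0>0. \<forall>h\<in>{0..h\<^sub>0}.
           \<not> (\<exists>x. bounded_solution (\<lambda>t x. - (x - piecewise_const \<Gamma> h t)\<^sup>2 + p t) x)"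
proof -
  define f where "f = (\<lambda>t y. - y\<^sup>2 + p t :: real)"
  have a: "caratheodory_solution f a" "bounded (range a)"
    and r: "caratheodory_solution f r" "bounded (range r)"
    using assms(2) by (auto simp: attractor_repeller_pair_def bounded_solution_def Let_def f_def)
  obtain k \<beta> where \<beta>: "\<beta> > 0"
    and ha: "\<forall>s t. s \<le> t \<longrightarrow> exp (LBINT l=ereal s..ereal t. - 2 * a l) \<le> k * exp (- \<beta> * (t - s))"
    and hr: "\<forall>s t. t \<le> s \<longrightarrow> exp (LBINT l=ereal s..ereal t. - 2 * r l) \<le> k * exp (\<beta> * (t - s))"
    using assms(2) unfolding attractor_repeller_pair_def by (elim conjE bexE exE)
  obtain \<Gamma>' \<Gamma>'' where \<Gamma>': "\<forall>t\<in>{t\<^sub>1..t\<^sub>2}. (\<Gamma> has_real_derivative \<Gamma>' t) (at t within {t\<^sub>1..t\<^sub>2})"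
    and \<Gamma>'': "\<forall>t\<in>{t\<^sub>1..t\<^sub>2}. (\<Gamma>' has_real_derivative \<Gamma>'' t) (at t within {t\<^sub>1..t\<^sub>2})"
    using assms(9) unfolding C2_on_def by (elim exE conjE)
  have c\<Gamma>': "continuous_on {t\<^sub>1..t\<^sub>2} \<Gamma>'"
    using \<Gamma>'' by (meson DERIV_continuous continuous_on_eq_continuous_within)
  have vd: "vector_derivative \<Gamma> (at t within {t\<^sub>1..t\<^sub>2}) = \<Gamma>' t" if "t \<in> {t\<^sub>1..t\<^sub>2}" for t
    using \<Gamma>' that assms(8)
    by (intro vector_derivative_within_cbox[of t\<^sub>1 t\<^sub>2, unfolded cbox_interval])
       (auto simp: has_real_derivative_iff_has_vector_derivative)
  define gap where "gap t = \<Gamma>' t - ((1 / 4 - (t\<^sub>1 + t\<^sub>2 - 2 * t)\<^sup>2 / (4 * (t\<^sub>2 - t\<^sub>1)\<^sup>2)) * (a t - r t)\<^sup>2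
             + 1 / (t\<^sub>2 - t\<^sub>1) * (a t - r t))" for t
  have "continuous_on {t\<^sub>1..t\<^sub>2} a" "continuous_on {t\<^sub>1..t\<^sub>2} r"
    using caratheodory_solution_continuous[OF a(1)] caratheodory_solution_continuous[OF r(1)]
    by (meson continuous_on_subset subset_UNIV)+
  then have "continuous_on {t\<^sub>1..t\<^sub>2} gap"
    unfolding gap_def using assms(8) by (intro continuous_intros c\<Gamma>') auto
  \<comment> \<open>Compactness turns the pointwise strict inequality into a uniform margin, the
    minimum of \<open>gap\<close>.\<close>
  then obtain m where m: "m \<in> {t\<^sub>1..t\<^sub>2}" "\<forall>t\<in>{t\<^sub>1..t\<^sub>2}. gap m \<le> gap t"
    using continuous_attains_inf[of "{t\<^sub>1..t\<^sub>2}" gap] assms(8) by auto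
  define \<epsilon> where "\<epsilon> = gap m"
  have \<epsilon>: "\<epsilon> > 0" using assms(10) vd m(1) by (auto simp: gap_def \<epsilon>_def)
  obtain M where M: "\<forall>t. \<bar>a t\<bar> \<le> M" "\<forall>t. \<bar>r t\<bar> \<le> M" "M > 0"
  proof -
    obtain Ma Mr where "\<forall>t. \<bar>a t\<bar> \<le> Ma" "\<forall>t. \<bar>r t\<bar> \<le> Mr"
      using a(2) r(2) by (auto simp: bounded_iff)
    then show ?thesis by (intro that[of "max 1 (max Ma Mr)"]) (auto intro: max.coboundedI1 max.coboundedI2)
  qed
  define T where "T = t\<^sub>2 - t\<^sub>1"
  have T: "T > 0" using assms(8) by (simp add: T_def)
  \<comment> \<open>\<kappa> spends half of the margin \<epsilon> on the accumulated gap; the other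
    half is left for the discretization error.\<close>
  define \<kappa> where "\<kappa> = \<epsilon> / (2 * (1 + 2 * M * T))"
  have den: "1 + 2 * M * T > 0" using M(3) T by (simp add: add_pos_pos)
  have \<kappa>: "\<kappa> > 0" "\<kappa> * (1 + 2 * M * T) = \<epsilon> / 2"
  proof -
    have "\<epsilon> / (2 * D) > 0 \<and> \<epsilon> / (2 * D) * D = \<epsilon> / 2" if "D > 0" for D
      using \<epsilon> that by simp
    from this[OF den] show "\<kappa> > 0" "\<kappa> * (1 + 2 * M * T) = \<epsilon> / 2" by (simp_all only: \<kappa>_def)
  qed
  \<comment> \<open>The first bound keeps the discretization error within its half of \<epsilon>;
    the second makes \<delta> smaller than the total gap \<open>\<kappa> * T\<close>, which will be
    the contradiction.\<close>
  define \<delta> where "\<delta> = min (\<epsilon> / (4 * M)) (\<kappa> * T / 2)"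
  have \<delta>: "\<delta> > 0" "2 * M * \<delta> \<le> \<epsilon> / 2" "\<delta> < \<kappa> * T"
  proof -
    show "\<delta> > 0" using \<epsilon> M(3) \<kappa>(1) T by (simp add: \<delta>_def)
    have "2 * M * \<delta> \<le> 2 * M * (\<epsilon> / (4 * M))" using M(3) by (intro mult_left_mono) (auto simp: \<delta>_def)
    then show "2 * M * \<delta> \<le> \<epsilon> / 2" using M(3) by simp
    have "\<delta> \<le> \<kappa> * T / 2" by (simp add: \<delta>_def)
    moreover have "\<kappa> * T > 0" using \<kappa>(1) T by simp
    ultimately show "\<delta> < \<kappa> * T" by linarith
  qed
  \<comment> \<open>The sampling point of a time near \<open>t\<^sub>1\<close> may lie up to
    \<open>h \<le> 1\<close> to its left, hence the enlarged interval.\<close>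
  have "uniformly_continuous_on {t\<^sub>1 - 1..t\<^sub>2} \<Gamma>"
    using assms(4) by (intro compact_uniformly_continuous) (auto intro: continuous_on_subset)
  then obtain \<eta> where \<eta>: "\<eta> > 0"
    "\<forall>t\<in>{t\<^sub>1 - 1..t\<^sub>2}. \<forall>s\<in>{t\<^sub>1 - 1..t\<^sub>2}. dist s t < \<eta> \<longrightarrow> dist (\<Gamma> s) (\<Gamma> t) < \<delta>"
    using \<delta>(1) unfolding uniformly_continuous_on_def by blast
  define h0 where "h0 = min 1 (\<eta> / 2)"
  have "\<not> (\<exists>x. bounded_solution (\<lambda>t x. - (x - piecewise_const \<Gamma> h t)\<^sup>2 + p t) x)" if h: "h \<in> {0..h0}" for h
  proof
    assume "\<exists>x. bounded_solution (\<lambda>t x. - (x - piecewise_const \<Gamma> h t)\<^sup>2 + p t) x"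
    then obtain x where x: "bounded_solution (\<lambda>t x. - (x - piecewise_const \<Gamma> h t)\<^sup>2 + p t) x" ..
    let ?G = "piecewise_const \<Gamma> h"
    have h': "0 \<le> h" "h \<le> 1" "h < \<eta>" using h \<eta>(1) by (auto simp: h0_def)
    have near: "?G t \<le> \<Gamma> t \<and> \<Gamma> t \<le> ?G t + \<delta>" if t: "t \<in> {t\<^sub>1..t\<^sub>2}" for t
    proof -
      obtain s where s: "t - h \<le> s" "s \<le> t" "?G t = \<Gamma> s"
        using piecewise_const_eq_near[OF h'(1)] by metis
      have "dist (\<Gamma> s) (\<Gamma> t) < \<delta>"
        using s t h' \<eta>(2) by (auto simp: dist_real_def)
      then show ?thesis using s monoD[OF assms(7) s(2)] by (auto simp: dist_real_def)
    qed
    note bounds = bounded_solution_shift_bounds[OF a(1)[unfolded f_def] r(1)[unfolded f_def] a(2) r(2) x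
        piecewise_const_mono[OF assms(7) h'(1)] piecewise_const_bounded[OF assms(3) h'(1)] \<beta>
        ha[rule_format] hr[rule_format]]
    \<comment> \<open>The confinement of \<open>x - G\<close> gives the two end conditions: it is at
      most \<open>a\<close> at \<open>t\<^sub>1\<close> and at least \<open>r\<close> at
      \<open>t\<^sub>2\<close>.\<close>
    have "\<kappa> * (t\<^sub>2 - t\<^sub>1) \<le> \<delta>"
    proof (rule supersolution_gap[OF a(1)[unfolded f_def] r(1)[unfolded f_def] _ assms(8)
          bspec[OF \<Gamma>'] c\<Gamma>' _ near spec[OF M(1)] spec[OF M(2)]])
      show "caratheodory_solution (\<lambda>t x. - (x - ?G t)\<^sup>2 + p t) x"
        using x by (simp add: bounded_solution_def)
      show "(1 / 4 - (t\<^sub>1 + t\<^sub>2 - 2 * t)\<^sup>2 / (4 * (t\<^sub>2 - t\<^sub>1)\<^sup>2)) * (a t - r t)\<^sup>2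
             + 1 / (t\<^sub>2 - t\<^sub>1) * (a t - r t) + \<epsilon> \<le> \<Gamma>' t" if "t \<in> {t\<^sub>1..t\<^sub>2}" for t
        using bspec[OF m(2) that] unfolding gap_def[of t] \<epsilon>_def[symmetric] by linarith
      show "0 \<le> \<kappa>" using \<kappa>(1) by simp
      show "2 * M * \<delta> + \<kappa> * (1 + 2 * M * (t\<^sub>2 - t\<^sub>1)) \<le> \<epsilon>"
        using \<kappa>(2) \<delta>(2) by (simp add: T_def)
      show "x t\<^sub>1 - ?G t\<^sub>1 \<le> a t\<^sub>1" by (rule bounds(2))
      show "r t\<^sub>2 \<le> x t\<^sub>2 - ?G t\<^sub>2" by (rule bounds(1))
    qed
    then show False using \<delta>(3) by (simp add: T_def)
  qed
  moreover have "h0 > 0" using \<eta>(1) by (simp add: h0_def)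
  ultimately show ?thesis by blast
qed

end
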